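(* Let $a,b,p,q$ be real numbers, let $(w_n)_{n\ge 0}$ be the Horadam sequence $w_0=a$, $w_1=b$, $w_n=pw_{n-1}+qw_{n-2}$ for $n\ge 2$, and let $\widehat{\mathbb{O}G_n}=\mathbb{O}G_n+\mathbb{O}G_{n+1}\epsilon$ be the $n$-th dual Horadam octonion. Then the generating function $g(t)=\sum_{n=0}^{\infty}\widehat{\mathbb{O}G_n}\,t^n$ is $$g(t)=\frac{\widehat{\mathbb{O}G_{0}}+\left(\widehat{\mathbb{O}G_{1}}-p\,\widehat{\mathbb{O}G_{0}}\right)t}{1-pt-qt^2}.$$
   Context: Let $\mathbb{O}$ be the real octonions with basis $e_0,\dots,e_7$, where $e_0=1$ is the identity. The $n$-th Horadam octonion is $\mathbb{O}G_n=w_ne_0+w_{n+1}e_1+\dots+w_{n+7}e_7$. A dual octonion is $\widehat K=(k,l)=k+l\epsilon$ with $k,l\in\mathbb{O}$, where $\epsilon\ne 0$, $\epsilon^2=0$; addition is componentwise. The dual Horadam octonion is $\widehat{\mathbb{O}G_n}=(\mathbb{O}G_n,\mathbb{O}G_{n+1})=\mathbb{O}G_n+\mathbb{O}G_{n+1}\epsilon$. The generating function is a formal power series in the indeterminate $t$ (commuting with all coefficients) with dual octonion coefficients. *)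

theory Defs
  imports Complex_Main "HOL-Computational_Algebra.Formal_Power_Series"
begin

fun horadam :: "real \<Rightarrow> real \<Rightarrow> real \<Rightarrow> real \<Rightarrow> nat \<Rightarrow> real" where
  "horadam a b p q 0 = a"
| "horadam a b p q (Suc 0) = b"
| "horadam a b p q (Suc (Suc n)) = p * horadam a b p q (Suc n) + q * horadam a b p q n"


section \<open>Octonions\<close>

datatype octonion = Octonion
  (oct0: real) (oct1: real) (oct2: real) (oct3: real) (oct4: real) (oct5: real) (oct6: real)
    (oct7: real)

lemma octonion_eq_iff:
  "x = y \<longleftrightarrow> oct0 x = oct0 y \<and> oct1 x = oct1 y \<and> oct2 x = oct2 y
    \<and> oct3 x = oct3 y \<and> oct4 x = oct4 y \<and> oct5 x = oct5 y \<and> oct6 x = oct6 y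
    \<and> oct7 x = oct7 y"
  by (cases x; cases y) simp

text \<open>
  The product is the bilinear extension of the table with identity \<open>e\<^sub>0\<close>,
  \<open>e\<^sub>i e\<^sub>i = - e\<^sub>0\<close> for \<open>i \<ge> 1\<close>, and \<open>e\<^sub>i e\<^sub>j = e\<^sub>k = - e\<^sub>j e\<^sub>i\<close> for \<open>(i, j, k)\<close> a cyclic
  rotation of one of the triples 123, 145, 176, 246, 257, 347, 365. This is the table
  of the Cayley-Dickson doubling of the quaternions,
  \<open>(a, b) (c, d) = (a c - d\<^sup>* b, d a + b c\<^sup>*)\<close> with
  \<open>e\<^sub>4 = (0, 1)\<close>, \<open>e\<^sub>5 = (0, i)\<close>, \<open>e\<^sub>6 = (0, j)\<close>, \<open>e\<^sub>7 = (0, k)\<close>.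
\<close>

instantiation octonion :: "{real_vector, zero_neq_one, mult_zero, inverse}"
begin

definition zero_octonion :: octonion where
  "0 = Octonion 0 0 0 0 0 0 0 0"

definition one_octonion :: octonion where
  "1 = Octonion 1 0 0 0 0 0 0 0"

definition plus_octonion :: "octonion \<Rightarrow> octonion \<Rightarrow> octonion" where
  "x + y = Octonion (oct0 x + oct0 y) (oct1 x + oct1 y) (oct2 x + oct2 y) (oct3 x + oct3 y)
    (oct4 x + oct4 y) (oct5 x + oct5 y) (oct6 x + oct6 y) (oct7 x + oct7 y)"

definition uminus_octonion :: "octonion \<Rightarrow> octonion" where
  "- x = Octonion (- oct0 x) (- oct1 x) (- oct2 x) (- oct3 x) (- oct4 x) (- oct5 x) (- oct6 x)
    (- oct7 x)"

definition minus_octonion :: "octonion \<Rightarrow> octonion \<Rightarrow> octonion" where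
  "x - y = Octonion (oct0 x - oct0 y) (oct1 x - oct1 y) (oct2 x - oct2 y) (oct3 x - oct3 y)
    (oct4 x - oct4 y) (oct5 x - oct5 y) (oct6 x - oct6 y) (oct7 x - oct7 y)"

definition scaleR_octonion :: "real \<Rightarrow> octonion \<Rightarrow> octonion" where
  "r *\<^sub>R x = Octonion (r * oct0 x) (r * oct1 x) (r * oct2 x) (r * oct3 x) (r * oct4 x)
    (r * oct5 x) (r * oct6 x) (r * oct7 x)"

definition times_octonion :: "octonion \<Rightarrow> octonion \<Rightarrow> octonion" where
  "x * y = Octonion
    (oct0 x * oct0 y - oct1 x * oct1 y - oct2 x * oct2 y - oct3 x * oct3 y - oct4 x * oct4 y
      - oct5 x * oct5 y - oct6 x * oct6 y - oct7 x * oct7 y)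
    (oct0 x * oct1 y + oct1 x * oct0 y + oct2 x * oct3 y - oct3 x * oct2 y + oct4 x * oct5 y
      - oct5 x * oct4 y - oct6 x * oct7 y + oct7 x * oct6 y)
    (oct0 x * oct2 y - oct1 x * oct3 y + oct2 x * oct0 y + oct3 x * oct1 y + oct4 x * oct6 y +
      oct5 x * oct7 y - oct6 x * oct4 y - oct7 x * oct5 y)
    (oct0 x * oct3 y + oct1 x * oct2 y - oct2 x * oct1 y + oct3 x * oct0 y + oct4 x * oct7 y
      - oct5 x * oct6 y + oct6 x * oct5 y - oct7 x * oct4 y)
    (oct0 x * oct4 y - oct1 x * oct5 y - oct2 x * oct6 y - oct3 x * oct7 y + oct4 x * oct0 y +
      oct5 x * oct1 y + oct6 x * oct2 y + oct7 x * oct3 y)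
    (oct0 x * oct5 y + oct1 x * oct4 y - oct2 x * oct7 y + oct3 x * oct6 y - oct4 x * oct1 y +
      oct5 x * oct0 y - oct6 x * oct3 y + oct7 x * oct2 y)
    (oct0 x * oct6 y + oct1 x * oct7 y + oct2 x * oct4 y - oct3 x * oct5 y - oct4 x * oct2 y +
      oct5 x * oct3 y + oct6 x * oct0 y - oct7 x * oct1 y)
    (oct0 x * oct7 y - oct1 x * oct6 y + oct2 x * oct5 y + oct3 x * oct4 y - oct4 x * oct3 y
      - oct5 x * oct2 y + oct6 x * oct1 y + oct7 x * oct0 y)"

text \<open>The inverse is the conjugate divided by the squared norm.\<close>

definition inverse_octonion :: "octonion \<Rightarrow> octonion" where
  "inverse x =
    inverse ((oct0 x)\<^sup>2 + (oct1 x)\<^sup>2 + (oct2 x)\<^sup>2 + (oct3 x)\<^sup>2 +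
      (oct4 x)\<^sup>2 + (oct5 x)\<^sup>2 + (oct6 x)\<^sup>2 + (oct7 x)\<^sup>2) *\<^sub>R
    Octonion (oct0 x) (- oct1 x) (- oct2 x) (- oct3 x) (- oct4 x) (- oct5 x) (- oct6 x) (- oct7 x)"

definition divide_octonion :: "octonion \<Rightarrow> octonion \<Rightarrow> octonion" where
  "x div y = x * inverse (y :: octonion)"

instance
  by standard
    (simp_all add: zero_octonion_def one_octonion_def plus_octonion_def uminus_octonion_def
      minus_octonion_def scaleR_octonion_def times_octonion_def algebra_simps)

end

lemmas octonion_defs = zero_octonion_def one_octonion_def plus_octonion_def uminus_octonion_def
  minus_octonion_def scaleR_octonion_def times_octonion_def

lemma octonion_mult_one [simp]: "1 * x = x" "x * 1 = x" for x :: octonion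
  by (simp_all add: octonion_defs octonion_eq_iff)

lemma octonion_distrib: "x * (y + z) = x * y + x * z" "(x + y) * z = x * z + y * z"
  for x y z :: octonion
  by (simp_all add: octonion_defs algebra_simps)

lemma octonion_scaleR_mult:
  "(r *\<^sub>R x) * y = r *\<^sub>R (x * y)" "x * (r *\<^sub>R y) = r *\<^sub>R (x * y)"
  for x y :: octonion
  by (simp_all add: octonion_defs algebra_simps)

lemma octonion_alternative: "x * (x * y) = (x * x) * y" "(y * x) * x = y * (x * x)"
  for x y :: octonion
  by (simp_all add: octonion_defs) algebra+

lemma octonion_inverse_mult: "inverse x * x = 1" "x * inverse x = 1"
  if "x \<noteq> 0" for x :: octonion
proof -
  define N where "N = (oct0 x)\<^sup>2 + (oct1 x)\<^sup>2 + (oct2 x)\<^sup>2 + (oct3 x)\<^sup>2 +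
    (oct4 x)\<^sup>2 + (oct5 x)\<^sup>2 + (oct6 x)\<^sup>2 + (oct7 x)\<^sup>2"
  have "N \<noteq> 0"
    using that unfolding N_def
    by (simp add: octonion_eq_iff zero_octonion_def add_nonneg_eq_0_iff)
  then have N: "inverse N * N = 1" by simp
  have inv: "inverse x = inverse N *\<^sub>R
    Octonion (oct0 x) (- oct1 x) (- oct2 x) (- oct3 x) (- oct4 x) (- oct5 x) (- oct6 x) (- oct7 x)"
    by (simp add: inverse_octonion_def N_def)
  have "Octonion (oct0 x) (- oct1 x) (- oct2 x) (- oct3 x) (- oct4 x) (- oct5 x) (- oct6 x)
    (- oct7 x) * x = N *\<^sub>R 1"
       "x * Octonion (oct0 x) (- oct1 x) (- oct2 x) (- oct3 x) (- oct4 x) (- oct5 x) (- oct6 x)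
         (- oct7 x) = N *\<^sub>R 1"
    by (simp_all add: octonion_defs N_def power2_eq_square)
  with N show "inverse x * x = 1" "x * inverse x = 1"
    by (simp_all add: inv octonion_scaleR_mult)
qed

definition octonion_e :: "nat \<Rightarrow> octonion" where
  "octonion_e i = Octonion (of_bool (i = 0)) (of_bool (i = 1)) (of_bool (i = 2)) (of_bool (i = 3))
    (of_bool (i = 4)) (of_bool (i = 5)) (of_bool (i = 6)) (of_bool (i = 7))"

definition horadam_octonion :: "real \<Rightarrow> real \<Rightarrow> real \<Rightarrow> real \<Rightarrow> nat \<Rightarrow> octonion" where
  "horadam_octonion a b p q n = (\<Sum>i<8. horadam a b p q (n + i) *\<^sub>R octonion_e i)"


section \<open>Dual octonions\<close>

datatype dual_octonion = Dual (re: octonion) (du: octonion)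

lemma dual_octonion_eq_iff: "x = y \<longleftrightarrow> re x = re y \<and> du x = du y"
  by (cases x; cases y) simp

text \<open>
  \<open>Dual k l\<close> is \<open>k + l \<epsilon>\<close>, and \<open>\<epsilon>\<close> commutes with octonions. The inverse of \<open>k + l \<epsilon>\<close> with
  \<open>k \<noteq> 0\<close> is \<open>k\<^sup>-\<^sup>1 - (k\<^sup>-\<^sup>1 l k\<^sup>-\<^sup>1) \<epsilon>\<close>; for \<open>k = 0\<close>, where no inverse exists, the
  definition gives \<open>0\<close>.
\<close>

instantiation dual_octonion :: "{real_vector, zero_neq_one, mult_zero, inverse}"
begin

definition zero_dual_octonion :: dual_octonion where
  "0 = Dual 0 0"

definition one_dual_octonion :: dual_octonion where
  "1 = Dual 1 0"

definition plus_dual_octonion :: "dual_octonion \<Rightarrow> dual_octonion \<Rightarrow> dual_octonion" where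
  "x + y = Dual (re x + re y) (du x + du y)"

definition uminus_dual_octonion :: "dual_octonion \<Rightarrow> dual_octonion" where
  "- x = Dual (- re x) (- du x)"

definition minus_dual_octonion :: "dual_octonion \<Rightarrow> dual_octonion \<Rightarrow> dual_octonion" where
  "x - y = Dual (re x - re y) (du x - du y)"

definition scaleR_dual_octonion :: "real \<Rightarrow> dual_octonion \<Rightarrow> dual_octonion" where
  "r *\<^sub>R x = Dual (r *\<^sub>R re x) (r *\<^sub>R du x)"

definition times_dual_octonion :: "dual_octonion \<Rightarrow> dual_octonion \<Rightarrow> dual_octonion" where
  "x * y = Dual (re x * re y) (re x * du y + du x * re y)"

definition inverse_dual_octonion :: "dual_octonion \<Rightarrow> dual_octonion" where
  "inverse x = Dual (inverse (re x)) (- ((inverse (re x) * du x) * inverse (re x)))"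

definition divide_dual_octonion :: "dual_octonion \<Rightarrow> dual_octonion \<Rightarrow> dual_octonion" where
  "x div y = x * inverse (y :: dual_octonion)"

instance
  by standard
    (simp_all add: zero_dual_octonion_def one_dual_octonion_def plus_dual_octonion_def
      uminus_dual_octonion_def minus_dual_octonion_def scaleR_dual_octonion_def
      times_dual_octonion_def algebra_simps)

end

lemmas dual_octonion_defs = zero_dual_octonion_def one_dual_octonion_def plus_dual_octonion_def
  uminus_dual_octonion_def minus_dual_octonion_def scaleR_dual_octonion_def
  times_dual_octonion_def

definition dual_eps :: dual_octonion where
  "dual_eps = Dual 0 1"

lemma dual_eps: "dual_eps \<noteq> 0" "dual_eps * dual_eps = 0"
  by (simp_all add: dual_eps_def dual_octonion_defs)

lemma Dual_eq: "Dual k l = Dual k 0 + Dual l 0 * dual_eps"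
  by (simp add: dual_eps_def dual_octonion_defs)

definition dual_horadam_octonion :: "real \<Rightarrow> real \<Rightarrow> real \<Rightarrow> real \<Rightarrow> nat \<Rightarrow> dual_octonion" where
  "dual_horadam_octonion a b p q n =
    Dual (horadam_octonion a b p q n) (horadam_octonion a b p q (Suc n))"


section \<open>Power series with dual octonion coefficients\<close>

text \<open>
  The library provides \<open>^\<close> on formal power series only over semirings, which are associative.
  Its \<open>0\<close>, \<open>1\<close>, \<open>+\<close>, \<open>-\<close>, \<open>*\<close>, \<open>inverse\<close> and \<open>/\<close> on formal power series, on the
  other hand, are available for dual octonion coefficients. There \<open>f / g\<close> is
  \<open>f * inverse g\<close> if \<open>g\<close> has non-zero constant term; for \<open>g\<close> with real coefficients,
  \<open>g\<close> and \<open>inverse g\<close> are central and the side of the factor is immaterial.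
\<close>

instance fps :: ("{comm_monoid_add, times, one}") power ..

end

theory Submission
  imports Defs
begin

unbundle fps_syntax

text \<open>The recurrence is linear with real coefficients, so index shifts preserve it and
  \<open>dual_horadam_octonion\<close> inherits it componentwise. Every sequence G with this
  recurrence has the claimed form (\<open>linear_recurrence_fps\<close>): if h_n are the
  coefficients of 1/(1 - p t - q t^2), then G_(n+1) and G_0 h_(n+1) + (G_1 - p G_0) h_n both satisfy
  the recurrence in n and agree at n = 0 and n = 1. The values h_0 = 1, h_1 = p and the recurrence
  for h come from \<open>inverse_fps_quadratic_nth\<close>.\<close>

lemma dual_octonion_mult_one [simp]: "1 * x = x" "x * 1 = x" for x :: dual_octonion
  by (simp_all add: dual_octonion_defs)

lemma dual_octonion_distrib: "x * (y + z) = x * y + x * z" "(x + y) * z = x * z + y * z"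
  for x y z :: dual_octonion
  by (simp_all add: dual_octonion_defs octonion_distrib)

text \<open>Moving real scalars through products does the work of associativity, as the denominator
  has only real multiples of 1 as coefficients.\<close>

lemma dual_octonion_scaleR_mult:
  "(r *\<^sub>R x) * y = r *\<^sub>R (x * y)" "x * (r *\<^sub>R y) = r *\<^sub>R (x * y)"
  for x y :: dual_octonion
  by (simp_all add: dual_octonion_defs octonion_scaleR_mult scaleR_add_right)

lemma dual_octonion_inverse_one [simp]: "inverse (1 :: dual_octonion) = 1"
proof -
  have "inverse (1 :: octonion) = 1"
    using octonion_inverse_mult(1)[of 1] by simp
  then show ?thesis
    by (simp add: inverse_dual_octonion_def one_dual_octonion_def)
qed

lemma horadam_octonion_rec:
  "horadam_octonion a b p q (Suc (Suc n)) =
    p *\<^sub>R horadam_octonion a b p q (Suc n) + q *\<^sub>R horadam_octonion a b p q n"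
  by (simp add: horadam_octonion_def scaleR_sum_right sum.distrib scaleR_add_left)

lemma dual_horadam_octonion_rec:
  "dual_horadam_octonion a b p q (Suc (Suc n)) =
    p *\<^sub>R dual_horadam_octonion a b p q (Suc n) + q *\<^sub>R dual_horadam_octonion a b p q n"
  by (simp add: dual_horadam_octonion_def horadam_octonion_rec dual_octonion_defs)

lemma fps_const_mult_nth: "(fps_const c * f) $ n = c * f $ n"
  for f :: "'a::{comm_monoid_add, mult_zero} fps"
  by (simp add: fps_mult_nth mult_delta_left)

lemma fps_X_mult_nth: "(fps_X * f) $ n = (if n = 0 then 0 else f $ (n - 1))"
  for f :: "dual_octonion fps"
  by (simp add: fps_mult_nth fps_X_def mult_delta_left)

lemma fps_X_power2_nth: "((fps_X :: dual_octonion fps) ^ 2) $ n = of_bool (n = 2)"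
  by (auto simp add: numeral_2_eq_2 fps_X_mult_nth)

lemma fps_linear_mult_nth_Suc:
  "((fps_const c + fps_const d * fps_X) * f) $ Suc n = c * f $ Suc n + d * f $ n"
  for f :: "dual_octonion fps"
proof -
  \<comment> \<open>The left factor has degree at most 1, so the convolution reduces to two
    indicator terms.\<close>
  have "((fps_const c + fps_const d * fps_X) * f) $ Suc n =
    (\<Sum>i = 0..Suc n. (if i = 0 then c * f $ Suc n else 0) + (if i = 1 then d * f $ n else 0))"
    unfolding fps_mult_nth[of _ f]
    by (intro sum.cong) (auto simp: fps_const_mult_nth)
  then show ?thesis
    by (simp add: sum.distrib del: sum.atLeast0_atMost_Suc)
qed

text \<open>The coefficients of \<open>inverse f\<close> solve f * inverse f = 1 recursively; since
  f has degree at most 2, each convolution has at most the terms i = 1 and i = 2.\<close>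

lemma inverse_fps_quadratic_nth:
  fixes p q :: real
  defines "f \<equiv> 1 - fps_const (p *\<^sub>R 1) * fps_X - fps_const (q *\<^sub>R 1) * fps_X ^ 2
    :: dual_octonion fps"
  shows "inverse f $ 0 = 1"
    and "inverse f $ Suc 0 = p *\<^sub>R 1"
    and "inverse f $ Suc (Suc n) = p *\<^sub>R (inverse f $ Suc n) + q *\<^sub>R (inverse f $ n)"
proof -
  have f: "f $ i = of_bool (i = 0) - p *\<^sub>R of_bool (i = 1) - q *\<^sub>R of_bool (i = 2)" for i
    by (auto simp: f_def fps_const_mult_nth fps_X_power2_nth)
  show zero: "inverse f $ 0 = 1"
    by (simp add: fps_inverse_def f)
  \<comment> \<open>The recursion for \<open>inverse f\<close> carries the factor
    \<open>- inverse (f $ 0)\<close>, which is \<open>- 1\<close> here.\<close>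
  have uminus_one: "- 1 * x = - x" for x :: dual_octonion
    using dual_octonion_scaleR_mult(1)[of "-1" 1 x] by simp
  have rec: "inverse f $ Suc m = - (\<Sum>i = 1..Suc m. f $ i * inverse f $ (Suc m - i))" for m
    by (simp add: fps_inverse_def f uminus_one del: sum.cl_ivl_Suc)
  show "inverse f $ Suc 0 = p *\<^sub>R 1"
    using rec[of 0] by (simp add: zero f)
  have "(\<Sum>i = 1..Suc (Suc n). f $ i * inverse f $ (Suc (Suc n) - i)) =
    (\<Sum>i = 1..Suc (Suc n). (if i = 1 then - (p *\<^sub>R (inverse f $ Suc n)) else 0) +
      (if i = 2 then - (q *\<^sub>R (inverse f $ n)) else 0))"
    using dual_octonion_scaleR_mult(1)[of "-p" 1] dual_octonion_scaleR_mult(1)[of "-q" 1]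
    by (intro sum.cong) (auto simp: f numeral_2_eq_2)
  then show "inverse f $ Suc (Suc n) = p *\<^sub>R (inverse f $ Suc n) + q *\<^sub>R (inverse f $ n)"
    unfolding rec[of "Suc n"] by (simp add: sum.distrib del: sum.cl_ivl_Suc)
qed

lemma linear_recurrence_fps:
  fixes G :: "nat \<Rightarrow> dual_octonion" and p q :: real
  assumes rec: "\<And>n. G (Suc (Suc n)) = p *\<^sub>R G (Suc n) + q *\<^sub>R G n"
  shows "Abs_fps G = (fps_const (G 0) + fps_const (G 1 - p *\<^sub>R G 0) * fps_X) /
    (1 - fps_const (p *\<^sub>R 1) * fps_X - fps_const (q *\<^sub>R 1) * fps_X ^ 2)"
    (is "_ = ?N / ?D")
proof -
  text \<open>Dual octonion multiplication is not associative, so instead of cross-multiplying by the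
    denominator the coefficients of its inverse are compared directly.\<close>
  define h where "h n = inverse ?D $ n" for n
  note h = inverse_fps_quadratic_nth[of p q, folded h_def]
  have closed_form: "G (Suc n) = G 0 * h (Suc n) + (G 1 - p *\<^sub>R G 0) * h n" for n
  \<comment> \<open>A second-order recurrence needs two base cases; at n = 0 the p G_0 terms cancel,
    at n = 1 the p^2 G_0 terms.\<close>
  proof (induction n rule: induct_nat_012)
    case 0
    show ?case
      by (simp add: h dual_octonion_scaleR_mult)
  next
    case 1
    show ?case
      by (simp add: h rec dual_octonion_scaleR_mult dual_octonion_distrib scaleR_diff_right)
  next
    case (ge2 n)
    show ?case
      unfolding rec[of "Suc n"] ge2 h(3)[of "Suc n"] h(3)[of n]
      by (simp only: dual_octonion_scaleR_mult dual_octonion_distrib scaleR_add_right ac_simps)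
  qed
  have "Abs_fps G $ n = (?N * inverse ?D) $ n" for n
  \<comment> \<open>The closed form covers coefficients from 1 on; the constant one is G_0 h_0 =
    G_0.\<close>
  proof (cases n)
    case 0
    have "inverse ?D $ 0 = 1" by (rule inverse_fps_quadratic_nth)
    then show ?thesis
      by (simp only: 0 fps_mult_nth_0 fps_nth_Abs_fps) (simp add: fps_const_mult_nth)
  next
    case (Suc m)
    with closed_form show ?thesis
      by (simp only: h_def fps_linear_mult_nth_Suc fps_nth_Abs_fps)
  qed
  then have "Abs_fps G = ?N * inverse ?D"
    by (rule fps_ext)
  \<comment> \<open>A non-zero constant term makes division the product with the inverse.\<close>
  moreover have "?D $ 0 \<noteq> 0"
    by (simp add: fps_const_mult_nth fps_X_power2_nth)
  ultimately show ?thesis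
    by (metis fps_divide_unit)
qed

theorem theorem3p2:
  fixes a b p q :: real
  shows "Abs_fps (dual_horadam_octonion a b p q) =
    (fps_const (dual_horadam_octonion a b p q 0) +
     fps_const (dual_horadam_octonion a b p q 1 - p *\<^sub>R dual_horadam_octonion a b p q 0) * fps_X) /
    (1 - fps_const (p *\<^sub>R 1) * fps_X - fps_const (q *\<^sub>R 1) * fps_X ^ 2)"
  by (rule linear_recurrence_fps) (rule dual_horadam_octonion_rec)

end
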